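(* Let $k\ge 1$ and $n\ge 1$ be integers. The number of $k$-Schröder paths of type A of size $n$ is given by $$|\mathtt{Sch}^{A}(n;k)|=\frac{1}{n}\sum_{j=0}^{n}\binom{n}{j}\binom{n+kj}{n-1}.$$
   Context: A $k$-Schröder path of type A of size $n$ is a lattice path from $(0,0)$ to $(kn,n)$ consisting of up steps $U=(0,1)$, down steps $D=(1,0)$ and horizontal steps $H=(k,1)$, which never goes below the line $y=x/k$. The set of such paths is denoted $\mathtt{Sch}^{A}(n;k)$. *)

theory Defs
  imports Complex_Main
begin

text \<open>
  A lattice path starting at the origin is represented by its list of steps.
\<close>

datatype step = U | D | H

fun step_vec :: "nat \<Rightarrow> step \<Rightarrow> nat \<times> nat" where
  "step_vec k U = (0, 1)"
| "step_vec k D = (1, 0)"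
| "step_vec k H = (k, 1)"

definition endpoint :: "nat \<Rightarrow> step list \<Rightarrow> nat \<times> nat" where
  "endpoint k p = ((\<Sum>s\<leftarrow>p. fst (step_vec k s)), (\<Sum>s\<leftarrow>p. snd (step_vec k s)))"

text \<open>
  The vertices of the path \<open>p\<close> are the endpoints of its prefixes. As the closed half-plane
  \<open>y \<ge> x / k\<close> is convex, the path never goes below the line \<open>y = x / k\<close> iff
  none of its vertices lies below it.
\<close>

definition weakly_above :: "nat \<Rightarrow> step list \<Rightarrow> bool" where
  "weakly_above k p \<longleftrightarrow>
     (\<forall>i \<le> length p. case endpoint k (take i p) of (x, y) \<Rightarrow> real y \<ge> real x / real k)"

definition Sch_A :: "nat \<Rightarrow> nat \<Rightarrow> step list set" where
  "Sch_A n k = {p. endpoint k p = (k * n, n) \<and> weakly_above k p}"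

end

theory Submission
  imports Defs
begin

text \<open>
  Give each step the increment it makes in the height \<open>k y - x\<close>: \<open>k\<close> for \<open>U\<close>, \<open>-1\<close> for \<open>D\<close>, \<open>0\<close> for
  \<open>H\<close>. A path is then a walk from height \<open>0\<close> to height \<open>0\<close> that stays nonnegative. Generalise the
  starting height to \<open>h\<close> and fix the numbers \<open>u\<close> of \<open>U\<close> and \<open>m\<close> of \<open>H\<close> steps. The walks are counted
  by the ballot-type expression
  \<open>(h + 1) (h + k u + u + m)! / (u! m! (h + 1 + k u)!)\<close>,
  which satisfies the recursion obtained by removing the first step. Setting \<open>h = 0\<close>, \<open>u = j\<close>,
  \<open>m = n - j\<close> gives the \<open>j\<close>-th summand.
\<close>

fun nonneg_from :: "nat \<Rightarrow> nat \<Rightarrow> step list \<Rightarrow> bool" where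
  "nonneg_from k h [] \<longleftrightarrow> True"
| "nonneg_from k h (U # p) \<longleftrightarrow> nonneg_from k (h + k) p"
| "nonneg_from k h (D # p) \<longleftrightarrow> h > 0 \<and> nonneg_from k (h - 1) p"
| "nonneg_from k h (H # p) \<longleftrightarrow> nonneg_from k h p"

text \<open>The number of \<open>D\<close> steps is pinned so that the walk ends at height
  0.\<close>

definition walks :: "nat \<Rightarrow> nat \<Rightarrow> nat \<Rightarrow> nat \<Rightarrow> step list set" where
  "walks k h u m = {p. nonneg_from k h p \<and> count_list p U = u \<and> count_list p H = m
                       \<and> count_list p D = h + k * u}"

text \<open>After a prefix ending at \<open>(x, y)\<close> the height is
  \<open>h + k * y - x\<close>; moving \<open>x\<close> across avoids truncated subtraction. The
  induction varies \<open>h\<close> because the first step changes the starting height.\<close>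

lemma nonneg_from_iff:
  "nonneg_from k h p \<longleftrightarrow>
     (\<forall>i \<le> length p. fst (endpoint k (take i p)) \<le> h + k * snd (endpoint k (take i p)))"
proof (induction p arbitrary: h)
  case Nil
  then show ?case by (simp add: endpoint_def)
next
  case (Cons s p)
  have split: "(\<forall>i \<le> length (s # p). Q i) \<longleftrightarrow> Q 0 \<and> (\<forall>i \<le> length p. Q (Suc i))" for Q
    using All_less_Suc2[of "Suc (length p)" Q] by (simp only: less_Suc_eq_le list.size add_0_right add_Suc_right)
  show ?case
  proof (cases s)
    case U
    show ?thesis
      unfolding split using Cons[of "h + k"] by (simp add: U endpoint_def algebra_simps)
  next
    case D
    show ?thesis
    proof (cases "h > 0")
      case True
      then show ?thesis
        unfolding split using Cons[of "h - 1"]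
        by (cases h) (auto simp: D endpoint_def)
    next
      case False
      then show ?thesis
        \<comment> \<open>Both sides fail: the prefix consisting of this \<open>D\<close> alone, at
          index 0 after \<open>split\<close>, already goes below 0.\<close>
        unfolding split by (auto simp: D endpoint_def intro!: exI[of _ 0])
    qed
  next
    case H
    show ?thesis
      unfolding split using Cons[of h] by (simp add: H endpoint_def algebra_simps)
  qed
qed

text \<open>Clearing the denominator needs \<open>k\<close> positive: for \<open>k = 0\<close> the
  quotient is 0 and every path would be weakly above.\<close>

lemma weakly_above_iff_nonneg_from:
  assumes "k \<ge> 1"
  shows "weakly_above k p \<longleftrightarrow> nonneg_from k 0 p"
proof -
  have "real y \<ge> real x / real k \<longleftrightarrow> x \<le> k * y" for x y
  proof -
    have "real y \<ge> real x / real k \<longleftrightarrow> real x \<le> real (k * y)"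
      using assms by (simp add: field_simps)
    then show ?thesis by (simp only: of_nat_le_iff)
  qed
  then show ?thesis
    by (simp add: weakly_above_def nonneg_from_iff case_prod_beta)
qed

lemma endpoint_eq_counts:
  "endpoint k p = (count_list p D + k * count_list p H, count_list p U + count_list p H)"
proof (induction p)
  case Nil
  then show ?case by (simp add: endpoint_def)
next
  case (Cons s p)
  then show ?case by (cases s) (auto simp: endpoint_def)
qed

text \<open>With \<open>j\<close> up steps, the second coordinate forces \<open>n - j\<close> steps
  \<open>H\<close>, and the first then forces \<open>k * j\<close> steps \<open>D\<close>.\<close>

lemma Sch_A_eq_walks:
  assumes "k \<ge> 1"
  shows "Sch_A n k = (\<Union>j\<in>{0..n}. walks k 0 j (n - j))"
  using assms
  by (auto simp: Sch_A_def walks_def weakly_above_iff_nonneg_from endpoint_eq_counts algebra_simps)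

lemma walks_first_step:
  "walks k h u m = (if h = 0 \<and> u = 0 \<and> m = 0 then {[]} else {})
     \<union> (if h > 0 then (#) D ` walks k (h - 1) u m else {})
     \<union> (if u > 0 then (#) U ` walks k (h + k) (u - 1) m else {})
     \<union> (if m > 0 then (#) H ` walks k h u (m - 1) else {})"
  (is "_ = ?R")
proof (rule set_eqI)
  fix p
  show "p \<in> walks k h u m \<longleftrightarrow> p \<in> ?R"
  proof (cases p)
    case Nil
    then show ?thesis by (auto simp: walks_def)
  next
    case (Cons s q)
    show ?thesis
      by (cases s; cases u; cases m) (auto simp: Cons walks_def image_iff)
  qed
qed

lemma finite_walks: "finite (walks k h u m)"
\<comment> \<open>The measure is the length of the walks, so removing the first step lowers it by
  one.\<close>
proof (induction "h + k * u + u + m" arbitrary: h u m rule: less_induct)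
  case less
  have "finite (walks k (h - 1) u m)" if "h > 0"
    using that by (intro less) auto
  moreover have "finite (walks k (h + k) (u - 1) m)" if "u > 0"
    using that by (intro less) (cases u; auto)
  moreover have "finite (walks k h u (m - 1))" if "m > 0"
    using that by (intro less) auto
  ultimately show ?case
    by (subst walks_first_step) auto
qed

text \<open>The ballot-type formula with denominators cleared, so that the induction stays in the
  natural numbers.\<close>

lemma card_walks:
  "card (walks k h u m) * (fact u * fact m * fact (h + 1 + k * u)) = (h + 1) * fact (h + k * u + u + m)"
proof (induction "h + k * u + u + m" arbitrary: h u m rule: less_induct)
  case less
  define N where "N = h + k * u + u + m"
  define F :: nat where "F = fact u * fact m * fact (h + 1 + k * u)"
  show ?case
  proof (cases "N = 0")
    case True
    then have "h = 0" "u = 0" "m = 0" by (auto simp: N_def)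
    then show ?thesis by (subst walks_first_step) simp
  next
    case False
    define A where "A = (if h > 0 then (#) D ` walks k (h - 1) u m else {})"
    define B where "B = (if u > 0 then (#) U ` walks k (h + k) (u - 1) m else {})"
    define C where "C = (if m > 0 then (#) H ` walks k h u (m - 1) else {})"
    have "walks k h u m = A \<union> B \<union> C"
      using False unfolding A_def B_def C_def N_def by (subst walks_first_step) auto
    moreover have "finite A" "finite B" "finite C"
      by (simp_all add: A_def B_def C_def finite_walks)
    moreover have "A \<inter> B = {}" "(A \<union> B) \<inter> C = {}"
      by (auto simp: A_def B_def C_def)
    ultimately have "card (walks k h u m) = card A + card B + card C"
      by (simp add: card_Un_disjoint)
    \<comment> \<open>A first step \<open>D\<close> lowers \<open>h\<close>, so the last factorial
      in \<open>F\<close> releases the factor \<open>h + 1 + k * u\<close>; the formula for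
      \<open>h - 1\<close> supplies \<open>h\<close>.\<close>
    moreover have "card A * F = h * (h + 1 + k * u) * fact (N - 1)"
    proof (cases h)
      case 0
      then show ?thesis by (simp add: A_def)
    next
      case (Suc h')
      have "card A = card (walks k h' u m)"
        by (simp add: A_def Suc card_image)
      moreover have "F = (h + 1 + k * u) * (fact u * fact m * fact (h' + 1 + k * u))"
        by (simp add: F_def Suc algebra_simps)
      ultimately have "card A * F = (h + 1 + k * u) *
          (card (walks k h' u m) * (fact u * fact m * fact (h' + 1 + k * u)))"
        by (simp only: mult_ac)
      also have "card (walks k h' u m) * (fact u * fact m * fact (h' + 1 + k * u)) = h * fact (N - 1)"
        using less[of h' u m] by (simp add: N_def Suc del: fact_Suc)
      finally show ?thesis by (simp only: mult_ac)
    qed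
    \<comment> \<open>Here \<open>h + 1 + k * u\<close> is unchanged, as \<open>h\<close> gains
      \<open>k\<close> while \<open>u\<close> drops by one; only \<open>fact u\<close> releases a
      factor.\<close>
    moreover have "card B * F = u * (h + k + 1) * fact (N - 1)"
    proof (cases u)
      case 0
      then show ?thesis by (simp add: B_def)
    next
      case (Suc u')
      have "card B = card (walks k (h + k) u' m)"
        by (simp add: B_def Suc card_image)
      moreover have "F = u * (fact u' * fact m * fact (h + k + 1 + k * u'))"
        by (simp add: F_def Suc algebra_simps)
      ultimately have "card B * F = u *
          (card (walks k (h + k) u' m) * (fact u' * fact m * fact (h + k + 1 + k * u')))"
        by (simp only: mult_ac)
      also have "card (walks k (h + k) u' m) * (fact u' * fact m * fact (h + k + 1 + k * u')) = (h + k + 1) * fact (N - 1)"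
        using less[of "h + k" u' m] by (simp add: N_def Suc add_ac del: fact_Suc)
      finally show ?thesis by (simp only: mult_ac)
    qed
    moreover have "card C * F = m * (h + 1) * fact (N - 1)"
    proof (cases m)
      case 0
      then show ?thesis by (simp add: C_def)
    next
      case (Suc m')
      have "card C = card (walks k h u m')"
        by (simp add: C_def Suc card_image)
      moreover have "F = m * (fact u * fact m' * fact (h + 1 + k * u))"
        by (simp add: F_def Suc algebra_simps)
      ultimately have "card C * F = m *
          (card (walks k h u m') * (fact u * fact m' * fact (h + 1 + k * u)))"
        by (simp only: mult_ac)
      also have "card (walks k h u m') * (fact u * fact m' * fact (h + 1 + k * u)) = (h + 1) * fact (N - 1)"
        using less[of h u m'] by (simp add: N_def Suc del: fact_Suc)
      finally show ?thesis by (simp only: mult_ac)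
    qed
    ultimately have "card (walks k h u m) * F
        = (h * (h + 1 + k * u) + u * (h + k + 1) + m * (h + 1)) * fact (N - 1)"
      by (simp add: distrib_right)
    also have "h * (h + 1 + k * u) + u * (h + k + 1) + m * (h + 1) = (h + 1) * N"
      by (simp add: N_def algebra_simps)
    also have "(h + 1) * N * fact (N - 1) = (h + 1) * fact N"
      using False by (simp add: fact_reduce[of N] algebra_simps)
    finally show ?thesis by (simp add: F_def N_def)
  qed
qed

lemma real_card_walks_from_0:
  assumes "n \<ge> 1" and "j \<le> n"
  shows "real (card (walks k 0 j (n - j)))
    = 1 / real n * (real (n choose j) * real ((n + k * j) choose (n - 1)))"
proof -
  have "real (card (walks k 0 j (n - j)) * (fact j * fact (n - j) * fact (0 + 1 + k * j)))
      = real ((0 + 1) * fact (0 + k * j + j + (n - j)))"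
    by (simp only: card_walks)
  then have "real (card (walks k 0 j (n - j)))
      = fact (n + k * j) / (fact j * fact (n - j) * fact (k * j + 1))"
    using assms(2) by (simp add: field_simps del: fact_Suc)
  \<comment> \<open>This matches the lower factorial of the binomial with the one in the walk count;
    the factor \<open>n\<close> of \<open>fact n\<close> later cancels \<open>1 / n\<close>.\<close>
  moreover have "n + k * j - (n - 1) = k * j + 1"
    using assms(1) by simp
  then have "real ((n + k * j) choose (n - 1)) = fact (n + k * j) / (fact (n - 1) * fact (k * j + 1))"
    using binomial_fact[of "n - 1" "n + k * j", where 'a = real] by simp
  moreover have "real (n choose j) = real n * fact (n - 1) / (fact j * fact (n - j))"
    using assms by (simp add: binomial_fact fact_reduce[of n])
  ultimately show ?thesis
    using assms(1) by (simp del: fact_Suc)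
qed

theorem proposition4p20:
  fixes n k :: nat
  assumes "k \<ge> 1" and "n \<ge> 1"
  shows "real (card (Sch_A n k)) =
    1 / real n * (\<Sum>j=0..n. real (n choose j) * real ((n + k * j) choose (n - 1)))"
proof -
  have "card (Sch_A n k) = (\<Sum>j=0..n. card (walks k 0 j (n - j)))"
    unfolding Sch_A_eq_walks[OF assms(1)]
    \<comment> \<open>The sets are disjoint because \<open>j\<close> is the number of
      \<open>U\<close> steps.\<close>
    by (rule card_UN_disjoint) (auto simp: finite_walks, auto simp: walks_def)
  then show ?thesis
    using assms(2) by (simp add: real_card_walks_from_0 sum_distrib_left)
qed

end
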